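(* Let $N\ge 2$, $R>0$, $p>1$, $i\in\{1,\dots,N-1\}$ and $f\in C((0,R))$. If there is a viscosity subsolution $u\in\mathrm{USC}(B_R\setminus\{0\})$ of $$-\lambda_i(D^2u)+|Du|^p=f(|x|)\quad\text{in }B_R\setminus\{0\},$$ then $$-\frac{p-1}{(pr)^{\frac{p}{p-1}}}\le f(r)\quad\text{for all }r\in(0,R).$$
   Context: $B_R\subset\mathbb{R}^N$ is the open ball of radius $R$ centered at $0$. For a real symmetric $N\times N$ matrix $X$, $\lambda_1(X)\le\dots\le\lambda_N(X)$ denote its eigenvalues in nondecreasing order. $\mathrm{USC}(\Omega)$ is the set of real-valued upper semicontinuous functions on $\Omega$. A function $u\in\mathrm{USC}(B_R\setminus\{0\})$ is a viscosity subsolution of the equation if, whenever $\varphi$ is $C^2$ and $u-\varphi$ has a local maximum at $x\in B_R\setminus\{0\}$, one has $-\lambda_i(D^2\varphi(x))+|D\varphi(x)|^p\le f(|x|)$. *)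

theory Defs
  imports "HOL-Analysis.Analysis" "HOL-Computational_Algebra.Computational_Algebra"
begin

definition charpoly :: "real^'n^'n \<Rightarrow> real poly" where
  "charpoly X = det (mat [:0, 1:] - map_matrix (\<lambda>a. [:a:]) X)"

text \<open>
  The \<open>i\<close>-th smallest eigenvalue, counted with multiplicity and numbered from \<open>i = 1\<close>.
  Only meant for symmetric \<open>X\<close>, whose characteristic polynomial splits over the reals, so
  that the list has exactly \<open>CARD('n)\<close> entries.
\<close>

definition eigval :: "nat \<Rightarrow> real^'n^'n \<Rightarrow> real" where
  "eigval i X = sorted_list_of_multiset (proots (charpoly X)) ! (i - 1)"

definition gradient :: "(real^'n \<Rightarrow> real) \<Rightarrow> real^'n \<Rightarrow> real^'n" where
  "gradient \<phi> x = (THE D. GDERIV \<phi> x :> D)"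

definition hessian :: "(real^'n \<Rightarrow> real) \<Rightarrow> real^'n \<Rightarrow> real^'n^'n" where
  "hessian \<phi> x = jacobian (gradient \<phi>) (at x)"

text \<open>Only meant for open \<open>\<Omega>\<close>.\<close>

definition C2_on :: "(real^'n) set \<Rightarrow> (real^'n \<Rightarrow> real) \<Rightarrow> bool" where
  "C2_on \<Omega> \<phi> \<longleftrightarrow>
     (\<forall>x\<in>\<Omega>. \<phi> differentiable (at x)) \<and>
     (\<forall>x\<in>\<Omega>. gradient \<phi> differentiable (at x)) \<and>
     continuous_on \<Omega> (hessian \<phi>)"

definition USC :: "'a::topological_space set \<Rightarrow> ('a \<Rightarrow> real) set" where
  "USC \<Omega> = {u. \<forall>x\<in>\<Omega>. \<forall>c. u x < c \<longrightarrow> (\<forall>\<^sub>F y in at x within \<Omega>. u y < c)}"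

definition local_max_at :: "'a::topological_space set \<Rightarrow> ('a \<Rightarrow> real) \<Rightarrow> 'a \<Rightarrow> bool" where
  "local_max_at \<Omega> w x \<longleftrightarrow> x \<in> \<Omega> \<and> (\<forall>\<^sub>F y in at x within \<Omega>. w y \<le> w x)"

text \<open>
  Viscosity subsolutions in \<open>\<Omega>\<close> of \<open>- \<lambda>\<^sub>i(D\<^sup>2u) + \<bar>Du\<bar>\<^sup>p = h(x)\<close>; the test
  functions are those of class \<open>C\<^sup>2\<close> on all of \<open>\<Omega>\<close>.
\<close>

definition viscosity_subsolution ::
  "nat \<Rightarrow> real \<Rightarrow> (real^'n \<Rightarrow> real) \<Rightarrow> (real^'n) set \<Rightarrow> (real^'n \<Rightarrow> real) \<Rightarrow> bool" where
  "viscosity_subsolution i p h \<Omega> u \<longleftrightarrow> u \<in> USC \<Omega> \<and>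
     (\<forall>\<phi> x. C2_on \<Omega> \<phi> \<and> local_max_at \<Omega> (\<lambda>y. u y - \<phi> y) x \<longrightarrow>
        - eigval i (hessian \<phi> x) + norm (gradient \<phi> x) powr p \<le> h x)"

end

theory Submission
  imports Defs
begin

text \<open>
  Near a sphere \<open>\<bar>x\<bar> = r\<close> the subsolution \<open>u\<close> is touched from above by a steep radial bowl
  \<open>\<phi>(x) = k (\<bar>x\<bar> - r)\<^sup>2\<close>. Since \<open>u\<close> is bounded above on a thin closed annulus around that sphere,
  while \<open>\<phi>\<close> vanishes on the sphere, for large \<open>k\<close> the maximum of \<open>u - \<phi>\<close> over the annulus
  (which exists by upper semicontinuity, \<open>USC_attains_sup\<close>) is not on its boundary. So it is a
  local maximum, at some point \<open>x\<close> with \<open>\<rho> = \<bar>x\<bar>\<close> close to \<open>r\<close>.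

  Write \<open>t = 2k(\<rho> - r)\<close> for the radial derivative of \<open>\<phi>\<close> at \<open>x\<close>. Its Hessian there has the eigenvalue
  \<open>t/\<rho>\<close> on the tangent space of the sphere and the second radial derivative \<open>2k\<close> along \<open>x\<close>. As
  \<open>t/\<rho> = 2k(1 - r/\<rho>) \<le> 2k\<close>, the radial eigenvalue is the largest one whatever the sign of \<open>t\<close>,
  and \<open>\<lambda>\<^sub>i = t/\<rho>\<close> for every \<open>i < N\<close> (\<open>eigval_scalar_plus_rank_one\<close>). The subsolution inequality
  becomes \<open>\<bar>t\<bar>\<^sup>p - t/\<rho> \<le> f(\<rho>)\<close>. Nothing is known about \<open>t\<close>, but minimising the left-hand side over
  \<open>t\<close> gives exactly \<open>-(p - 1) / (p\<rho>)\<^sup>q\<close> with \<open>q = p/(p - 1)\<close>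
  (\<open>powr_minus_linear_ge\<close>, which is Young's inequality). Hence the claimed bound holds at radii
  arbitrarily close to \<open>r\<close>, and by continuity of \<open>f\<close> at \<open>r\<close> itself.
\<close>

(* From here on the dollar sign is the vector index, not the power series coefficient. *)
unbundle no Formal_Power_Series.fps_syntax

section \<open>Eigenvalues of a rank-one perturbation of a scalar matrix\<close>

definition scalar_plus_rank_one :: "real \<Rightarrow> real \<Rightarrow> real^'n \<Rightarrow> real^'n^'n" where
  "scalar_plus_rank_one a b x = (\<chi> i j. (if i = j then a else 0) + b * (x $ i * x $ j))"

text \<open>
  An orthogonal change of basis that sends a coordinate axis to the line through \<open>x\<close> makes the
  matrix diagonal, with \<open>a + b\<bar>x\<bar>\<^sup>2\<close> on that axis and \<open>a\<close> on all others.
\<close>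

lemma det_scalar_plus_rank_one:
  fixes x :: "real^'n"
  shows "det (scalar_plus_rank_one a b x) = a ^ (CARD('n) - 1) * (a + b * (norm x)\<^sup>2)"
proof -
  obtain k :: 'n where True by simp
  obtain f :: "real^'n \<Rightarrow> real^'n" where f: "orthogonal_transformation f" "f (norm x *\<^sub>R axis k 1) = x"
    by (rule orthogonal_transformation_exists[of "norm x *\<^sub>R axis k 1" x]) auto
  define A where "A = matrix f"
  have orth: "orthogonal_matrix A"
    using f(1) by (simp add: A_def orthogonal_transformation_matrix)
  have "A *v (norm x *\<^sub>R axis k 1) = x"
    using f by (simp add: A_def orthogonal_transformation_def linear_matrix_vector_mul_eq)
  hence x: "x $ m = norm x * A $ m $ k" for m
    by (metis matrix_vector_mult_scaleR vector_scaleR_component matrix_vector_mult_basis column_def vec_lambda_beta real_scaleR_def)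
  define D :: "real^'n^'n"
    where "D = (\<chi> i j. if i = j then (if i = k then a + b * (norm x)\<^sup>2 else a) else 0)"
  have one: "(\<Sum>l\<in>UNIV. A $ m $ l * A $ n $ l) = (if m = n then 1 else 0)" for m n
  proof -
    have "(A ** transpose A) $ m $ n = mat 1 $ m $ n"
      using orth by (simp add: orthogonal_matrix_def)
    thus ?thesis by (simp add: matrix_matrix_mult_def transpose_def mat_def)
  qed
  have "(A ** D ** transpose A) $ m $ n = scalar_plus_rank_one a b x $ m $ n" for m n
  proof -
    have AD: "(A ** D) $ m $ l = A $ m $ l * D $ l $ l" for l
    proof -
      have "(A ** D) $ m $ l = (\<Sum>j\<in>UNIV. A $ m $ j * D $ j $ l)"
        by (simp add: matrix_matrix_mult_def)
      also have "\<dots> = (\<Sum>j\<in>UNIV. if j = l then A $ m $ l * D $ l $ l else 0)"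
        by (rule sum.cong) (auto simp: D_def)
      finally show ?thesis by simp
    qed
    have "(A ** D ** transpose A) $ m $ n = (\<Sum>l\<in>UNIV. (A ** D) $ m $ l * A $ n $ l)"
      by (simp add: matrix_matrix_mult_def transpose_def)
    also have "\<dots> = (\<Sum>l\<in>UNIV. a * (A $ m $ l * A $ n $ l)
                     + (if l = k then b * (norm x)\<^sup>2 * (A $ m $ k * A $ n $ k) else 0))"
      unfolding AD by (rule sum.cong) (auto simp: D_def algebra_simps)
    also have "\<dots> = a * (if m = n then 1 else 0) + b * (norm x)\<^sup>2 * (A $ m $ k * A $ n $ k)"
      by (simp add: sum.distrib one flip: sum_distrib_left)
    also have "\<dots> = scalar_plus_rank_one a b x $ m $ n"
      by (simp add: scalar_plus_rank_one_def x[of m] x[of n] power2_eq_square)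
    finally show ?thesis .
  qed
  hence "scalar_plus_rank_one a b x = A ** D ** transpose A" by (simp add: vec_eq_iff)
  hence "det (scalar_plus_rank_one a b x) = det (A ** transpose A) * det D"
    by (simp add: det_mul)
  also have "\<dots> = det D" using orth by (simp add: orthogonal_matrix_def)
  also have "\<dots> = (\<Prod>i\<in>UNIV. D $ i $ i)" by (rule det_diagonal) (simp add: D_def)
  also have "\<dots> = (a + b * (norm x)\<^sup>2) * (\<Prod>i\<in>UNIV - {k}. D $ i $ i)"
    by (subst prod.remove[of _ k]) (auto simp: D_def)
  also have "(\<Prod>i\<in>UNIV - {k}. D $ i $ i) = (\<Prod>i\<in>UNIV - {k}. a)"
    by (rule prod.cong) (auto simp: D_def)
  finally show ?thesis by (simp add: mult.commute)
qed

lemma poly_charpoly: "poly (charpoly X) y = det (mat y - X)"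
  unfolding charpoly_def det_def poly_sum poly_mult poly_prod poly_of_int
  by (intro sum.cong refl arg_cong2[where f = "(*)"] prod.cong)
     (auto simp: mat_def map_matrix_def)

text \<open>
  The characteristic matrix is again a scalar matrix plus one of rank one at every real point, so
  both polynomials take the same values; over an infinite field this determines them.
\<close>

lemma charpoly_scalar_plus_rank_one:
  fixes x :: "real^'n"
  shows "charpoly (scalar_plus_rank_one a b x) = [:- a, 1:] ^ (CARD('n) - 1) * [:- (a + b * (norm x)\<^sup>2), 1:]"
proof -
  have "poly (charpoly (scalar_plus_rank_one a b x)) y
      = poly ([:- a, 1:] ^ (CARD('n) - 1) * [:- (a + b * (norm x)\<^sup>2), 1:]) y" for y
  proof -
    have "mat y - scalar_plus_rank_one a b x = scalar_plus_rank_one (y - a) (- b) x"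
      by (simp add: vec_eq_iff scalar_plus_rank_one_def mat_def)
    thus ?thesis by (simp add: poly_charpoly det_scalar_plus_rank_one algebra_simps)
  qed
  thus ?thesis by (metis poly_eq_poly_eq_iff ext)
qed

text \<open>
  Because \<open>b \<ge> 0\<close>, the exceptional eigenvalue \<open>a + b\<bar>x\<bar>\<^sup>2\<close> comes last in the sorted list, after
  \<open>N - 1\<close> copies of \<open>a\<close>.
\<close>

lemma eigval_scalar_plus_rank_one:
  fixes x :: "real^'n"
  assumes "b \<ge> 0" "i \<in> {1..CARD('n) - 1}"
  shows "eigval i (scalar_plus_rank_one a b x) = a"
proof -
  let ?n = "CARD('n) - 1" and ?c = "a + b * (norm x)\<^sup>2"
  have "proots (charpoly (scalar_plus_rank_one a b x)) = repeat_mset ?n {#a#} + {#?c#}"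
    unfolding charpoly_scalar_plus_rank_one by (subst proots_mult) (simp_all add: proots_power)
  also have "\<dots> = mset (replicate ?n a @ [?c])"
    by (simp add: mset_replicate repeat_mset_replicate_mset[of _ 1, simplified])
  finally have "sorted_list_of_multiset (proots (charpoly (scalar_plus_rank_one a b x)))
      = sort (replicate ?n a @ [?c])"
    by (metis sorted_list_of_multiset_mset)
  also have "\<dots> = replicate ?n a @ [?c]"
    by (rule sorted_sort_id) (use assms in \<open>auto simp: sorted_append\<close>)
  finally show ?thesis
    using assms(2) by (auto simp: eigval_def nth_append)
qed

section \<open>Gradient and Hessian of a radial bowl\<close>

lemma gradient_eqI: "GDERIV \<phi> x :> D \<Longrightarrow> gradient \<phi> x = D"
  unfolding gradient_def
proof (rule the_equality)
  fix E assume "GDERIV \<phi> x :> D" "GDERIV \<phi> x :> E"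
  hence "(\<lambda>h. inner h D) = (\<lambda>h. inner h E)"
    unfolding gderiv_def by (rule has_derivative_unique)
  thus "E = D" by (metis vector_eq_ldot)
qed

context
  fixes k r :: real and \<phi> :: "real^'n \<Rightarrow> real"
  assumes \<phi>: "\<phi> = (\<lambda>y. k * (norm y - r)\<^sup>2)"
begin

lemma GDERIV_bowl:
  assumes "x \<noteq> 0"
  shows "GDERIV \<phi> x :> (2 * k * (1 - r / norm x)) *\<^sub>R x"
proof -
  have "GDERIV (\<lambda>y. k * (norm y - r)\<^sup>2) x :> (2 * k * (norm x - r)) *\<^sub>R sgn x"
    by (rule GDERIV_DERIV_compose[where g = "\<lambda>t. k * (t - r)\<^sup>2", OF GDERIV_norm[OF assms]])
       (auto intro!: derivative_eq_intros)
  thus ?thesis using assms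
    by (simp add: \<phi> sgn_div_norm divide_simps)
qed

lemmas gradient_bowl = gradient_eqI[OF GDERIV_bowl]

lemma has_derivative_gradient_bowl:
  assumes "x \<noteq> 0"
  shows "(gradient \<phi> has_derivative
    (\<lambda>h. (2 * k * (1 - r / norm x)) *\<^sub>R h + (2 * k * r / norm x ^ 3 * (h \<bullet> x)) *\<^sub>R x)) (at x)"
proof (rule has_derivative_transform_within_open[of _ _ _ _ "- {0}"])
  show "((\<lambda>y. (2 * k * (1 - r / norm y)) *\<^sub>R y) has_derivative
    (\<lambda>h. (2 * k * (1 - r / norm x)) *\<^sub>R h + (2 * k * r / norm x ^ 3 * (h \<bullet> x)) *\<^sub>R x)) (at x)"
  proof -
    have "((\<lambda>y. 2 * k * (1 - r / norm y)) has_derivative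
      (\<lambda>h. 2 * k * r / norm x ^ 3 * (h \<bullet> x))) (at x)"
    proof -
      have "GDERIV (\<lambda>y. 2 * k * (1 - r / norm y)) x :> (2 * k * r / (norm x)\<^sup>2) *\<^sub>R sgn x"
        by (rule GDERIV_DERIV_compose[where g = "\<lambda>t. 2 * k * (1 - r / t)", OF GDERIV_norm[OF assms]])
           (use assms in \<open>auto intro!: derivative_eq_intros simp: power2_eq_square\<close>)
      thus ?thesis
        by (simp add: gderiv_def sgn_div_norm power2_eq_square power3_eq_cube divide_inverse mult_ac)
    qed
    thus ?thesis
      by (rule has_derivative_scaleR[OF _ has_derivative_ident])
  qed
qed (use assms gradient_bowl in auto)

text \<open>
  With \<open>\<rho> = \<bar>x\<bar>\<close>, the scalar part \<open>2k(1 - r/\<rho>)\<close> is the radial derivative divided by \<open>\<rho>\<close>, the curvature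
  of \<open>\<phi>\<close> in tangential directions; in direction \<open>x\<close> the rank-one part adds \<open>2kr/\<rho>\<close>, which gives the
  second radial derivative \<open>2k\<close>.
\<close>

lemma hessian_bowl:
  assumes "x \<noteq> 0"
  shows "hessian \<phi> x = scalar_plus_rank_one (2 * k * (1 - r / norm x)) (2 * k * r / norm x ^ 3) x"
  unfolding hessian_def jacobian_def
    frechet_derivative_at[OF has_derivative_gradient_bowl[OF assms], symmetric]
  by (auto simp: vec_eq_iff matrix_def scalar_plus_rank_one_def inner_axis') (auto simp: axis_def)

lemma C2_on_bowl:
  assumes "0 \<notin> \<Omega>"
  shows "C2_on \<Omega> \<phi>"
proof -
  have "continuous_on \<Omega> (\<lambda>x::real^'n. scalar_plus_rank_one (2 * k * (1 - r / norm x)) (2 * k * r / norm x ^ 3) x)"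
  proof -
    have "continuous_on \<Omega> (\<lambda>x::real^'n. if i = j then 2 * k * (1 - r / norm x) else 0)" for i j :: 'n
      using assms by (cases "i = j") (auto intro!: continuous_intros)
    thus ?thesis
      unfolding scalar_plus_rank_one_def using assms by (auto intro!: continuous_intros)
  qed
  hence "continuous_on \<Omega> (hessian \<phi>)"
    by (rule continuous_on_eq) (use assms in \<open>metis hessian_bowl\<close>)
  moreover have "\<phi> differentiable (at x)" "gradient \<phi> differentiable (at x)" if "x \<in> \<Omega>" for x
  proof -
    have "x \<noteq> 0" using that assms by blast
    thus "\<phi> differentiable (at x)" "gradient \<phi> differentiable (at x)"
      using GDERIV_bowl[unfolded gderiv_def] has_derivative_gradient_bowl
      by (blast intro: differentiableI)+
  qed
  ultimately show ?thesis by (simp add: C2_on_def)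
qed

end

section \<open>Upper semicontinuous functions attain their maximum\<close>

lemma USC_subset: "u \<in> USC \<Omega> \<Longrightarrow> K \<subseteq> \<Omega> \<Longrightarrow> u \<in> USC K"
  unfolding USC_def by (blast dest: filter_leD[OF at_le])

lemma USC_diff_continuous:
  assumes "u \<in> USC K" "continuous_on K g"
  shows "(\<lambda>x. u x - g x) \<in> USC K"
  unfolding USC_def
proof (safe)
  fix x c assume x: "x \<in> K" and c: "u x - g x < c"
  define e where "e = (c - (u x - g x)) / 2"
  have e: "e > 0" using c by (simp add: e_def)
  have "\<forall>\<^sub>F y in at x within K. u y < u x + e"
    using assms(1) x e by (auto simp: USC_def)
  moreover have "\<forall>\<^sub>F y in at x within K. g x - e < g y"
    using assms(2) x e by (intro order_tendstoD(1)[of g "g x"]) (auto simp: continuous_on_def)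
  ultimately show "\<forall>\<^sub>F y in at x within K. u y - g y < c"
  proof eventually_elim
    case (elim y)
    have "u x + e - (g x - e) = c" unfolding e_def by argo
    with elim show ?case by linarith
  qed
qed

text \<open>
  If no maximum were attained, the relatively open sets \<open>{y. w y < w z}\<close> would cover \<open>K\<close>. In a finite
  subcover the one with the largest \<open>w z\<close> contains all the others, yet it misses the point \<open>z\<close>.
\<close>

lemma USC_attains_sup:
  assumes K: "compact K" "K \<noteq> {}" and w: "w \<in> USC K"
  obtains x where "x \<in> K" "\<And>y. y \<in> K \<Longrightarrow> w y \<le> w x"
proof -
  have "\<exists>x\<in>K. \<forall>y\<in>K. w y \<le> w x"
  proof (rule ccontr)
    assume "\<not> ?thesis"
    hence no: "\<forall>x\<in>K. \<exists>y\<in>K. w x < w y" by (meson not_le)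
    let ?U = "\<lambda>z. {y \<in> K. w y < w z}"
    have "openin (top_of_set K) (?U z)" for z
    proof (subst openin_subopen, safe)
      fix y assume y: "y \<in> K" "w y < w z"
      hence "\<forall>\<^sub>F y' in at y within K. w y' < w z" using w by (auto simp: USC_def)
      then obtain S where S: "open S" "y \<in> S" "\<And>y'. y' \<in> S \<Longrightarrow> y' \<noteq> y \<Longrightarrow> y' \<in> K \<Longrightarrow> w y' < w z"
        unfolding eventually_at_topological by blast
      show "\<exists>T. openin (top_of_set K) T \<and> y \<in> T \<and> T \<subseteq> ?U z"
        by (rule exI[of _ "K \<inter> S"]) (use S y in \<open>auto simp: openin_open_Int\<close>)
    qed
    moreover have "K \<subseteq> \<Union> (?U ` K)" using no by auto
    ultimately obtain D where D: "D \<subseteq> ?U ` K" "finite D" "K \<subseteq> \<Union> D"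
      using K(1) unfolding compact_eq_openin_cover by (metis (no_types, lifting) imageE)
    obtain F where F: "F \<subseteq> K" "finite F" "D = ?U ` F"
      using finite_subset_image[OF D(2,1)] by blast
    have "F \<noteq> {}" using F D K(2) by auto
    hence "Max (w ` F) \<in> w ` F" using F(2) by (intro Max_in) auto
    then obtain z where z: "z \<in> F" "w z = Max (w ` F)" by auto
    hence zmax: "\<forall>y\<in>F. w y \<le> w z" using F(2) by simp
    have "z \<in> K" using z F by auto
    then obtain y where "y \<in> F" "w z < w y" using D F by auto
    thus False using zmax by fastforce
  qed
  thus thesis using that by blast
qed

section \<open>The bound on the right-hand side\<close>

text \<open>
  Young's inequality for \<open>\<bar>t\<bar>/\<rho> = (c\<bar>t\<bar>) \<cdot> (1/(c\<rho>))\<close>, where \<open>c\<^sup>p = p\<close> is chosen to turn the first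
  term \<open>(c\<bar>t\<bar>)\<^sup>p / p\<close> into \<open>\<bar>t\<bar>\<^sup>p\<close>. The constant is the true minimum over \<open>t\<close>.
\<close>

lemma powr_minus_linear_ge:
  fixes t \<rho> p :: real
  assumes "\<rho> > 0" "p > 1"
  shows "- ((p - 1) / (p * \<rho>) powr (p / (p - 1))) \<le> \<bar>t\<bar> powr p - t / \<rho>"
proof -
  define q where "q = p / (p - 1)"
  have q: "q > 1" "1 / p + 1 / q = 1" using assms by (auto simp: q_def field_simps)
  define c where "c = p powr (1 / p)"
  have c: "c > 0" "c powr p = p" using assms by (auto simp: c_def powr_powr)
  have "p powr q = p powr (1 + q / p)" using q assms
    by (intro arg_cong[where f = "(powr) p"]) (simp add: q_def field_simps)
  hence cq: "p powr q = p * c powr q"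
    using assms by (simp add: c_def powr_powr powr_add)
  have "\<bar>t\<bar> / \<rho> = (c * \<bar>t\<bar>) * (1 / (c * \<rho>))" using c by simp
  also have "\<dots> \<le> (c * \<bar>t\<bar>) powr p / p + (1 / (c * \<rho>)) powr q / q"
    using assms c q by (intro Youngs_inequality) auto
  also have "(c * \<bar>t\<bar>) powr p / p = \<bar>t\<bar> powr p" using c assms by (simp add: powr_mult)
  also have "(1 / (c * \<rho>)) powr q / q = (p - 1) / (p * \<rho>) powr q"
    using assms c by (simp add: powr_divide powr_mult cq) (simp add: q_def)
  finally have "\<bar>t\<bar> / \<rho> \<le> \<bar>t\<bar> powr p + (p - 1) / (p * \<rho>) powr q" .
  moreover have "t / \<rho> \<le> \<bar>t\<bar> / \<rho>" using assms by (intro divide_right_mono) auto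
  ultimately show ?thesis by (simp add: q_def)
qed

text \<open>
  The touching point of the steep bowl can only be located up to \<open>\<delta>\<close>, so the bound is obtained at some nearby radius
  \<open>\<rho>\<close> instead of \<open>r\<close>.
\<close>

lemma subsolution_bound_near:
  fixes u :: "real^'n \<Rightarrow> real"
  assumes "p > 1" and i: "i \<in> {1..CARD('n) - 1}"
    and sub: "viscosity_subsolution i p (\<lambda>x. f (norm x)) (ball 0 R - {0}) u"
    and "0 < \<delta>" "\<delta> < r" "r + \<delta> < R"
  obtains \<rho> where "\<bar>\<rho> - r\<bar> < \<delta>"
    "- ((p - 1) / (p * \<rho>) powr (p / (p - 1))) \<le> f \<rho>"
proof -
  let ?\<Omega> = "ball (0::real^'n) R - {0}"
  define K :: "(real^'n) set" where "K = {x. \<bar>norm x - r\<bar> \<le> \<delta>}"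
  have K\<Omega>: "K \<subseteq> ?\<Omega>" using assms by (auto simp: K_def)
  have "closed K" unfolding K_def by (intro closed_Collect_le continuous_intros)
  moreover have "bounded K" unfolding K_def bounded_iff by (intro exI[of _ "r + \<delta>"]) auto
  ultimately have K: "compact K" by (simp add: compact_eq_bounded_closed)
  obtain x0 :: "real^'n" where x0: "norm x0 = r"
    using vector_choose_size[of r] assms by auto
  have x0K: "x0 \<in> K" using x0 assms by (simp add: K_def)
  hence ne: "K \<noteq> {}" by auto
  have uK: "u \<in> USC K"
    using sub K\<Omega> by (auto simp: viscosity_subsolution_def intro: USC_subset)
  obtain xM where xM: "\<And>y. y \<in> K \<Longrightarrow> u y \<le> u xM"
    using USC_attains_sup[OF K ne uK] by blast
  \<comment> \<open>On the boundary of \<open>K\<close> the bowl then has height \<open>u xM - u x0 + 1\<close>, so \<open>u - \<phi>\<close> is below \<open>u x0\<close>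
    there; the summand \<open>1\<close> makes this strict and \<open>k\<close> positive.\<close>
  define k where "k = (u xM - u x0 + 1) / \<delta>\<^sup>2"
  have kpos: "k > 0" using xM[OF x0K] assms by (simp add: k_def)
  define \<phi> where "\<phi> = (\<lambda>y::real^'n. k * (norm y - r)\<^sup>2)"
  have "(\<lambda>y. u y - \<phi> y) \<in> USC K"
    using uK unfolding \<phi>_def by (intro USC_diff_continuous continuous_intros)
  then obtain x where x: "x \<in> K" "\<And>y. y \<in> K \<Longrightarrow> u y - \<phi> y \<le> u x - \<phi> x"
    using USC_attains_sup[OF K ne] by blast
  have "u x0 \<le> u x - k * (norm x - r)\<^sup>2"
    using x(2)[OF x0K] by (simp add: \<phi>_def x0)
  hence "k * (norm x - r)\<^sup>2 < k * \<delta>\<^sup>2"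
    using xM[OF x(1)] assms by (simp add: k_def)
  hence "\<bar>norm x - r\<bar>\<^sup>2 < \<delta>\<^sup>2" using kpos by simp
  hence near: "\<bar>norm x - r\<bar> < \<delta>" using assms by (intro power2_less_imp_less[of _ \<delta>]) auto
  have x\<Omega>: "x \<in> ?\<Omega>" using x(1) K\<Omega> by blast
  have "open {y::real^'n. \<bar>norm y - r\<bar> < \<delta>}" by (intro open_Collect_less continuous_intros)
  hence "\<forall>\<^sub>F y in at x within ?\<Omega>. \<bar>norm y - r\<bar> < \<delta>"
    using near unfolding eventually_at_topological by blast
  hence "\<forall>\<^sub>F y in at x within ?\<Omega>. u y - \<phi> y \<le> u x - \<phi> x"
    by eventually_elim (intro x(2), simp add: K_def)
  hence "local_max_at ?\<Omega> (\<lambda>y. u y - \<phi> y) x"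
    using x\<Omega> by (simp add: local_max_at_def)
  moreover have "C2_on ?\<Omega> \<phi>" by (rule C2_on_bowl[OF \<phi>_def]) simp
  ultimately have visc: "- eigval i (hessian \<phi> x) + norm (gradient \<phi> x) powr p \<le> f (norm x)"
    using sub unfolding viscosity_subsolution_def by blast
  have xnz: "x \<noteq> 0" using x\<Omega> by auto
  define t where "t = 2 * k * (norm x - r)"
  have "eigval i (hessian \<phi> x) = t / norm x"
    using kpos assms xnz i
    by (simp add: hessian_bowl[OF \<phi>_def] eigval_scalar_plus_rank_one t_def divide_simps)
  moreover have "norm (gradient \<phi> x) = \<bar>t\<bar>"
    using xnz kpos by (simp add: gradient_bowl[OF \<phi>_def] t_def abs_mult) (simp add: field_simps abs_if)
  ultimately have "- ((p - 1) / (p * norm x) powr (p / (p - 1))) \<le> f (norm x)"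
    using visc powr_minus_linear_ge[of "norm x" p t] assms xnz by simp
  thus thesis using that near by blast
qed

theorem proposition3p1:
  fixes R p :: real and i :: nat and f :: "real \<Rightarrow> real"
  assumes "CARD('n::finite) \<ge> 2" and "R > 0" and "p > 1"
    and "i \<in> {1..CARD('n) - 1}"
    and "continuous_on {0<..<R} f"
    and "\<exists>u :: real^'n \<Rightarrow> real.
           viscosity_subsolution i p (\<lambda>x. f (norm x)) (ball 0 R - {0}) u"
  shows "\<forall>r\<in>{0<..<R}. - ((p - 1) / (p * r) powr (p / (p - 1))) \<le> f r"
proof
  fix r assume r: "r \<in> {0<..<R}"
  obtain u :: "real^'n \<Rightarrow> real"
    where u: "viscosity_subsolution i p (\<lambda>x. f (norm x)) (ball 0 R - {0}) u"
    using assms by blast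
  define g where "g = (\<lambda>\<rho>. f \<rho> + (p - 1) / (p * \<rho>) powr (p / (p - 1)))"
  have "continuous_on {0<..<R} g"
    unfolding g_def using assms by (intro continuous_intros) auto
  hence cont: "isCont g r"
    using r by (simp add: continuous_on_eq_continuous_at)
  have "0 \<le> g r"
  proof (rule ccontr)
    assume "\<not> ?thesis"
    hence "\<forall>\<^sub>F \<rho> in nhds r. g \<rho> < 0"
      using cont by (intro order_tendstoD(2)[of g "g r"]) (simp_all add: continuous_within tendsto_at_iff_tendsto_nhds)
    then obtain d where d: "d > 0" "\<And>\<rho>. \<bar>\<rho> - r\<bar> < d \<Longrightarrow> g \<rho> < 0"
      unfolding eventually_nhds_metric by (auto simp: dist_real_def)
    define \<delta> where "\<delta> = min d (min r (R - r)) / 2"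
    have \<delta>: "0 < \<delta>" "\<delta> < r" "r + \<delta> < R" "\<delta> < d" using r d(1) by (auto simp: \<delta>_def min_def field_simps)
    obtain \<rho> where "\<bar>\<rho> - r\<bar> < \<delta>" "- ((p - 1) / (p * \<rho>) powr (p / (p - 1))) \<le> f \<rho>"
      using subsolution_bound_near[OF assms(3,4) u \<delta>(1-3)] by blast
    thus False using d(2)[of \<rho>] \<delta> by (simp add: g_def)
  qed
  thus "- ((p - 1) / (p * r) powr (p / (p - 1))) \<le> f r" by (simp add: g_def)
qed

end
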